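(* Let $r>\frac12$ and for $s>0$ let $y(s,r)=s+\mathop{K}_{n=1}^{\infty}\left(\dfrac{(2n-1)^2r^2-(r-1)^2}{2s}\right)$. Then, as $s\to+\infty$, $$y(s,r)\sim s\exp\left\{-\sum_{n=1}^{\infty}\dfrac{\sum_{k=0}^{n}\binom{2n}{2k}(r-1)^{2k}r^{2(n-k)}E_{2(n-k)}}{2n\,s^{2n}}\right\}.$$
   Context: $\mathop{K}_{n=1}^{\infty}\left(\frac{a_n}{b_n}\right)$ denotes the continued fraction $\cfrac{a_1}{b_1+\cfrac{a_2}{b_2+\cdots}}$ (limit of convergents). $E_m$ are the Euler numbers, defined by $\frac{1}{\cosh x}=\sum_{m\ge0}\frac{E_m}{m!}x^m$ (so $E_0=1$, $E_2=-1$, $E_4=5$, odd ones vanish). The relation $y(s)\sim s\exp\{F(s)\}$ with $F$ a formal power series in $1/s$ without constant term means that $y(s)/s$ has the asymptotic (Poincaré) expansion in powers of $1/s$ as $s\to+\infty$ obtained by substituting $F$ into the formal series $\exp(x)=\sum_{m\ge0}x^m/m!$ and collecting coefficients. *)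

theory Defs
  imports "HOL-Analysis.Analysis" "HOL-Computational_Algebra.Formal_Power_Series"
    "HOL-Library.Landau_Symbols"
begin

fun cf_aux :: "(nat \<Rightarrow> real) \<Rightarrow> (nat \<Rightarrow> real) \<Rightarrow> nat \<Rightarrow> nat \<Rightarrow> real" where
  "cf_aux a b 0 m = 0"
| "cf_aux a b (Suc k) m = a m / (b m + cf_aux a b k (Suc m))"

definition cf_convergent :: "(nat \<Rightarrow> real) \<Rightarrow> (nat \<Rightarrow> real) \<Rightarrow> nat \<Rightarrow> real" where
  "cf_convergent a b n = cf_aux a b n 1"

definition cf_value :: "(nat \<Rightarrow> real) \<Rightarrow> (nat \<Rightarrow> real) \<Rightarrow> real" where
  "cf_value a b = lim (cf_convergent a b)"

definition fps_cosh_series :: "real fps" where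
  "fps_cosh_series = Abs_fps (\<lambda>n. if even n then 1 / fact n else 0)"

definition euler_num :: "nat \<Rightarrow> real" where
  "euler_num m = fact m * fps_nth (inverse fps_cosh_series) m"

definition has_asymp_expansion :: "(real \<Rightarrow> real) \<Rightarrow> real fps \<Rightarrow> bool" where
  "has_asymp_expansion f A \<longleftrightarrow>
     (\<forall>N::nat. (\<lambda>s. f s - (\<Sum>m\<le>N. fps_nth A m / s ^ m)) \<in> o[at_top](\<lambda>s. 1 / s ^ N))"

text \<open>exp of a formal power series without constant term: substitution into exp(x).\<close>
definition fps_exp_of :: "real fps \<Rightarrow> real fps" where
  "fps_exp_of F = fps_compose (fps_exp 1) F"

end

theory Submission
  imports Defs
begin

text \<open>
  The partial numerators \<open>a n = ((2 * n - 2) * r + 1) * (2 * n * r - 1)\<close> are positive, and the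
  Bauer-Muir transformation with modifiers \<open>w n = 2 * r * n - s\<close> turns the continued fraction at
  \<open>s\<close> into the one at \<open>s + 2 * r\<close>. This gives \<open>y s * y (s + 2 * r) = (s + 1) * (s + 2 * r - 1)\<close>,
  that is, for \<open>L s = ln (y s / s)\<close>,
  \<open>L (u - r) + L (u + r) = ln (u\<^sup>2 - (r - 1)\<^sup>2) - ln (u\<^sup>2 - r\<^sup>2)\<close>.
  The exponent in the theorem solves this equation formally, because its coefficients are those of
  \<open>cosh ((r - 1) * x) / cosh (r * x)\<close>. Hence a truncation \<open>P\<close> of it solves the equation up to a small error;
  since \<open>L - P\<close> vanishes at infinity, the equation transfers the error bound to \<open>L - P\<close>.
\<close>

section \<open>Continued fractions with positive elements\<close>

text \<open>Index \<open>n + 1\<close> carries the usual \<open>n\<close>-th numerator or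
  denominator. Arbitrary start values cover both at once and let the Bauer-Muir identity be stated
  for every solution of the recurrence.\<close>

fun cf_rec :: "(nat \<Rightarrow> real) \<Rightarrow> real \<Rightarrow> real \<Rightarrow> real \<Rightarrow> nat \<Rightarrow> real" where
  "cf_rec a b x y 0 = x"
| "cf_rec a b x y (Suc 0) = y"
| "cf_rec a b x y (Suc (Suc n)) = b * cf_rec a b x y (Suc n) + a (Suc n) * cf_rec a b x y n"

lemma cf_aux_nonneg:
  assumes "b > 0" "\<And>n. n > 0 \<Longrightarrow> a n > 0" "m > 0"
  shows "cf_aux a (\<lambda>_. b) k m \<ge> 0"
  using assms(3)
proof (induction k arbitrary: m)
  case (Suc k)
  from Suc.IH[of "Suc m"] assms(1) assms(2)[OF Suc.prems] show ?case
    by simp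
qed simp

lemma cf_aux_le:
  assumes "b > 0" "\<And>n. n > 0 \<Longrightarrow> a n > 0" "m > 0"
  shows "cf_aux a (\<lambda>_. b) k m \<le> a m / b"
proof (cases k)
  case 0
  with assms(1) assms(2)[OF assms(3)] show ?thesis by simp
next
  case (Suc k')
  have "cf_aux a (\<lambda>_. b) k' (Suc m) \<ge> 0"
    using assms by (intro cf_aux_nonneg) auto
  with Suc assms(1) assms(2)[OF assms(3)] show ?thesis
    by (auto intro!: divide_left_mono mult_pos_pos)
qed

text \<open>The quadratic bound keeps \<open>1 / sqrt (a n)\<close> above a multiple of
  \<open>1 / n\<close>, and the divergence of the harmonic series then forces convergence. The
  leading term \<open>s\<close> is not tied to \<open>b\<close> here.\<close>

locale positive_cf =
  fixes a :: "nat \<Rightarrow> real" and b s K :: real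
  assumes b_pos: "b > 0" and K_pos: "K > 0" and a_pos: "n > 0 \<Longrightarrow> a n > 0"
    and a_le: "n > 0 \<Longrightarrow> a n \<le> (K * real n)\<^sup>2"
begin

definition num :: "nat \<Rightarrow> real" where "num = cf_rec a b 1 s"
definition den :: "nat \<Rightarrow> real" where "den = cf_rec a b 0 1"
definition aprod :: "nat \<Rightarrow> real" where "aprod n = (\<Prod>i=1..n. a i)"

lemma num_simps [simp]:
  "num 0 = 1" "num (Suc 0) = s" "num (Suc (Suc n)) = b * num (Suc n) + a (Suc n) * num n"
  by (simp_all add: num_def)

lemma den_simps [simp]:
  "den 0 = 0" "den (Suc 0) = 1" "den (Suc (Suc n)) = b * den (Suc n) + a (Suc n) * den n"
  by (simp_all add: den_def)

lemma aprod_simps [simp]: "aprod 0 = 1" "aprod (Suc n) = aprod n * a (Suc n)"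
  by (simp_all add: aprod_def)

lemma aprod_pos: "aprod n > 0"
  unfolding aprod_def by (intro prod_pos) (auto intro: a_pos)

lemma den_pos: "den (Suc n) > 0"
proof -
  have "den n \<ge> 0 \<and> den (Suc n) > 0"
    using b_pos by (induction n) (auto intro!: add_pos_nonneg simp: less_imp_le[OF a_pos])
  then show ?thesis ..
qed

lemma den_nonneg: "den n \<ge> 0"
  using den_pos[of "n - 1"] by (cases n) auto

text \<open>A tail \<open>a (m + 1) / (b + x)\<close> at level \<open>m\<close> acts like the tail
  \<open>x\<close> at level \<open>m + 1\<close>, since clearing the denominator reproduces the
  recurrence. The case \<open>m = 0\<close> identifies the convergents with quotients of
  \<open>num\<close> and \<open>den\<close>.\<close>

lemma tail_convergent:
  "(num (Suc m) + cf_aux a (\<lambda>_. b) k (Suc m) * num m) /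
     (den (Suc m) + cf_aux a (\<lambda>_. b) k (Suc m) * den m) = num (Suc (m + k)) / den (Suc (m + k))"
proof (induction k arbitrary: m)
  case (Suc k)
  define x where "x = cf_aux a (\<lambda>_. b) k (Suc (Suc m))"
  have "x \<ge> 0"
    unfolding x_def using b_pos a_pos by (intro cf_aux_nonneg) auto
  with b_pos have bx: "b + x > 0" by simp
  define c where "c = b + x"
  have c: "c > 0" "x = c - b" using bx by (simp_all add: c_def)
  have "(num (Suc m) + a (Suc m) / c * num m) / (den (Suc m) + a (Suc m) / c * den m)
      = (c * (num (Suc m) + a (Suc m) / c * num m)) / (c * (den (Suc m) + a (Suc m) / c * den m))"
    using c by simp
  also have "c * (num (Suc m) + a (Suc m) / c * num m) = num (Suc (Suc m)) + x * num (Suc m)"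
    using c(1) by (simp add: c(2) algebra_simps)
  also have "c * (den (Suc m) + a (Suc m) / c * den m) = den (Suc (Suc m)) + x * den (Suc m)"
    using c(1) by (simp add: c(2) algebra_simps)
  also have "(num (Suc (Suc m)) + x * num (Suc m)) / (den (Suc (Suc m)) + x * den (Suc m))
      = num (Suc (m + Suc k)) / den (Suc (m + Suc k))"
    using Suc.IH[of "Suc m"] by (simp add: x_def)
  finally show ?case by (simp add: c_def x_def)
qed simp

section \<open>Convergence through the gaps between successive convergents\<close>

definition conv :: "nat \<Rightarrow> real" where "conv n = num (Suc n) / den (Suc n)"

lemma conv_eq: "conv n = s + cf_convergent a (\<lambda>_. b) n"
  using tail_convergent[of 0 n] by (simp add: conv_def cf_convergent_def)

text \<open>Both sequences solve the same recurrence, and each step multiplies their Casoratian by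
  \<open>- a (n + 1)\<close>.\<close>

lemma determinant: "num (Suc n) * den n - num n * den (Suc n) = (-1) ^ Suc n * aprod n"
proof (induction n)
  case (Suc n)
  have "num (Suc (Suc n)) * den (Suc n) - num (Suc n) * den (Suc (Suc n))
      = - a (Suc n) * (num (Suc n) * den n - num n * den (Suc n))"
    by (simp add: algebra_simps)
  also have "\<dots> = (-1) ^ Suc (Suc n) * aprod (Suc n)"
    by (simp only: Suc.IH) simp
  finally show ?case .
qed simp

text \<open>The reciprocal of the distance between convergents \<open>n\<close> and
  \<open>n + 1\<close>. Reciprocals are convenient because they grow by explicit positive
  increments.\<close>

definition inv_gap :: "nat \<Rightarrow> real" where
  "inv_gap n = den (Suc n) * den (Suc (Suc n)) / aprod (Suc n)"

lemma inv_gap_pos: "inv_gap n > 0"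
  unfolding inv_gap_def using den_pos aprod_pos by (intro divide_pos_pos mult_pos_pos) blast+

lemma conv_Suc: "conv (Suc n) - conv n = (-1) ^ n * (1 / inv_gap n)"
proof -
  have "conv (Suc n) - conv n =
      (num (Suc (Suc n)) * den (Suc n) - num (Suc n) * den (Suc (Suc n)))
        / (den (Suc n) * den (Suc (Suc n)))"
    using den_pos[of n] den_pos[of "Suc n"]
    unfolding conv_def by (subst diff_frac_eq) (auto simp: mult_ac)
  also have "\<dots> = (-1) ^ Suc (Suc n) * aprod (Suc n) / (den (Suc n) * den (Suc (Suc n)))"
    by (simp only: determinant)
  finally show ?thesis by (simp add: inv_gap_def)
qed

text \<open>Over the common denominator \<open>aprod (n + 2)\<close>, the two terms are the two
  summands of the recurrence for \<open>den (n + 3)\<close>, each times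
  \<open>den (n + 2)\<close>.\<close>

lemma inv_gap_Suc: "inv_gap (Suc n) = inv_gap n + b * (den (Suc (Suc n)))\<^sup>2 / aprod (Suc (Suc n))"
proof -
  have "inv_gap n = (a (Suc (Suc n)) * den (Suc n) * den (Suc (Suc n))) / aprod (Suc (Suc n))"
    using a_pos[of "Suc (Suc n)"] by (simp add: inv_gap_def)
  then have "inv_gap n + b * (den (Suc (Suc n)))\<^sup>2 / aprod (Suc (Suc n)) =
      den (Suc (Suc n)) * (b * den (Suc (Suc n)) + a (Suc (Suc n)) * den (Suc n)) / aprod (Suc (Suc n))"
    by (simp add: add_divide_distrib [symmetric] power2_eq_square algebra_simps del: den_simps aprod_simps)
  then show ?thesis by (simp only: inv_gap_def den_simps)
qed

lemma incseq_inv_gap: "incseq inv_gap"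
proof (rule incseq_SucI)
  fix n
  have "b * (den (Suc (Suc n)))\<^sup>2 / aprod (Suc (Suc n)) \<ge> 0"
    using b_pos aprod_pos[of "Suc (Suc n)"] by (intro divide_nonneg_nonneg) auto
  then show "inv_gap n \<le> inv_gap (Suc n)" unfolding inv_gap_Suc by linarith
qed

text \<open>By AM-GM two consecutive increments dominate a term of the harmonic series.\<close>
lemma inv_gap_growth:
  "inv_gap (Suc (Suc n)) - inv_gap n \<ge> 2 * b * inv_gap 0 / (K * real (n + 3))"
proof -
  define x y p where "x = den (Suc (Suc n))" and "y = den (Suc (Suc (Suc n)))"
    and "p = aprod (Suc (Suc n))"
  define q where "q = sqrt (a (n + 3))"
  have a3: "a (n + 3) > 0" using a_pos[of "n + 3"] by simp
  then have q: "q > 0" "q\<^sup>2 = a (n + 3)" by (auto simp: q_def)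
  have x: "x > 0" "y > 0" "p > 0" unfolding x_def y_def p_def
    using den_pos aprod_pos by blast+
  have "inv_gap (Suc (Suc n)) - inv_gap n = b * x\<^sup>2 / p + b * y\<^sup>2 / (p * q\<^sup>2)"
    unfolding inv_gap_Suc x_def y_def p_def q(2)
    by (simp add: eval_nat_numeral del: den_simps)
  also have "\<dots> = b / p * (x - y / q)\<^sup>2 + 2 * b / q * (x * y / p)"
    using q(1) x by (simp add: field_simps power2_eq_square)
  also have "\<dots> \<ge> 2 * b / q * (x * y / p)" using b_pos x by simp
  also have "x * y / p = inv_gap (Suc n)" by (simp only: inv_gap_def x_def y_def p_def)
  finally have 1: "inv_gap (Suc (Suc n)) - inv_gap n \<ge> 2 * b / q * inv_gap (Suc n)" .
  have "q \<le> K * real (n + 3)"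
    unfolding q_def using a_le[of "n + 3"] K_pos by (intro real_le_lsqrt) auto
  then have "2 * b / (K * real (n + 3)) * inv_gap 0 \<le> 2 * b / q * inv_gap (Suc n)"
    using b_pos q K_pos incseqD[OF incseq_inv_gap, of 0 "Suc n"] inv_gap_pos[of 0]
    by (intro mult_mono divide_left_mono) auto
  with 1 show ?thesis by simp
qed

lemma inv_gap_at_top: "filterlim inv_gap at_top sequentially"
proof -
  define c where "c = b * inv_gap 0 / K"
  have c: "c > 0" using b_pos K_pos inv_gap_pos[of 0] by (simp add: c_def)
  \<comment> \<open>Passing from \<open>n\<close> to \<open>n + 1\<close> changes the left side by
    \<open>inv_gap (n + 2) - inv_gap n\<close>, so the two-step growth bound telescopes into a
    harmonic sum.\<close>
  have lower: "inv_gap n + inv_gap (Suc n) \<ge> 2 * c * (harm (n + 2) - harm 2)" for n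
  proof (induction n)
    case 0
    then show ?case using inv_gap_pos[of 0] inv_gap_pos[of 1] by (simp add: numeral_2_eq_2)
  next
    case (Suc n)
    have "harm (Suc n + 2) = harm (n + 2) + 1 / real (n + 3)"
      using harm_Suc[of "n + 2", where 'a = real] by (simp add: field_simps)
    then have "2 * c * (harm (Suc n + 2) - harm 2) = 2 * c * (harm (n + 2) - harm 2) + 2 * c / real (n + 3)"
      by (simp add: algebra_simps)
    also have "\<dots> \<le> inv_gap n + inv_gap (Suc n) + (inv_gap (Suc (Suc n)) - inv_gap n)"
      using Suc.IH inv_gap_growth[of n] by (intro add_mono) (simp_all add: c_def)
    finally show ?case by simp
  qed
  \<comment> \<open>By monotonicity the later of the two summands is at least half of their
    sum.\<close>
  have "c * (harm (n + 2) - harm 2) \<le> inv_gap (Suc n)" for n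
    using lower[of n] incseqD[OF incseq_inv_gap, of n "Suc n"] by simp
  moreover have "filterlim (\<lambda>n. c * (harm (n + 2) - harm 2)) at_top sequentially"
  proof -
    have "filterlim (\<lambda>n. harm (n + 2) :: real) at_top sequentially"
      by (rule filterlim_compose[OF harm_at_top filterlim_add_const_nat_at_top])
    then have "filterlim (\<lambda>n. - harm 2 + harm (n + 2) :: real) at_top sequentially"
      by (rule filterlim_tendsto_add_at_top[OF tendsto_const])
    then show ?thesis
      using filterlim_tendsto_pos_mult_at_top[OF tendsto_const c] by simp
  qed
  ultimately have "filterlim (\<lambda>n. inv_gap (Suc n)) at_top sequentially"
    by (intro filterlim_at_top_mono[of _ _ "\<lambda>n. inv_gap (Suc n)"]) auto
  then show ?thesis by (simp add: filterlim_sequentially_Suc)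
qed

text \<open>Differences of successive convergents alternate in sign and decrease to 0 in size, so
  the Leibniz criterion applies. Only this convergence gives the \<open>lim\<close> inside
  \<open>cf_value\<close> its meaning.\<close>

lemma conv_tendsto: "conv \<longlonglongrightarrow> s + cf_value a (\<lambda>_. b)"
proof -
  have "(\<lambda>n. 1 / inv_gap n) \<longlonglongrightarrow> 0"
    by (rule tendsto_divide_0[OF tendsto_const filterlim_at_top_imp_at_infinity[OF inv_gap_at_top]])
  then have "summable (\<lambda>n. (-1) ^ n * (1 / inv_gap n))"
    using inv_gap_pos incseqD[OF incseq_inv_gap]
    by (intro summable_Leibniz'(1)) (auto intro!: divide_left_mono simp: less_imp_le)
  then have "(\<lambda>n. \<Sum>i<n. conv (Suc i) - conv i) \<longlonglongrightarrow> (\<Sum>i. conv (Suc i) - conv i)"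
    unfolding conv_Suc by (rule summable_LIMSEQ)
  then have "convergent (\<lambda>n. conv n - conv 0)"
    by (auto simp: sum_lessThan_telescope convergent_def)
  then have "convergent conv"
    using convergent_diff_const_right_iff[of conv "conv 0"] by simp
  moreover have "cf_convergent a (\<lambda>_. b) = (\<lambda>n. conv n - s)"
    by (simp add: conv_eq)
  ultimately have "convergent (cf_convergent a (\<lambda>_. b))"
    by (simp add: convergent_diff_const_right_iff)
  then have "cf_convergent a (\<lambda>_. b) \<longlonglongrightarrow> cf_value a (\<lambda>_. b)"
    by (simp add: cf_value_def convergent_LIMSEQ_iff)
  from tendsto_add[OF tendsto_const this, of s] show ?thesis
    unfolding conv_eq .
qed

text \<open>With \<open>w n\<close> nonnegative, the modified convergent is a weighted mean of
  \<open>conv (n + 1)\<close> and \<open>conv n\<close> with weights \<open>den (n + 2)\<close> and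
  \<open>w n * den (n + 1)\<close>, so it is squeezed to the same limit.\<close>

lemma modified_convergent_tendsto:
  assumes "eventually (\<lambda>n. w n \<ge> 0) sequentially"
  shows "(\<lambda>n. (num (Suc (Suc n)) + w n * num (Suc n)) / (den (Suc (Suc n)) + w n * den (Suc n)))
           \<longlonglongrightarrow> s + cf_value a (\<lambda>_. b)"
proof (rule tendsto_sandwich)
  let ?M = "\<lambda>n. (num (Suc (Suc n)) + w n * num (Suc n)) / (den (Suc (Suc n)) + w n * den (Suc n))"
  have bounds: "min (conv (Suc n)) (conv n) \<le> ?M n \<and> ?M n \<le> max (conv (Suc n)) (conv n)"
    if w: "w n \<ge> 0" for n
  proof -
    define x y where "x = den (Suc (Suc n))" and "y = w n * den (Suc n)"
    have x: "x > 0" unfolding x_def by (rule den_pos)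
    have y: "y \<ge> 0" unfolding y_def using w den_nonneg by simp
    have "num (Suc (Suc n)) = x * conv (Suc n)"
      using x unfolding conv_def x_def by (simp del: den_simps)
    moreover have "w n * num (Suc n) = y * conv n"
      using den_pos[of n] unfolding conv_def y_def by (simp del: den_simps)
    ultimately have M: "?M n = (x * conv (Suc n) + y * conv n) / (x + y)"
      by (simp only: x_def y_def)
    have "x * min (conv (Suc n)) (conv n) + y * min (conv (Suc n)) (conv n)
        \<le> x * conv (Suc n) + y * conv n"
      using x y by (intro add_mono mult_left_mono) auto
    moreover have "x * conv (Suc n) + y * conv n
        \<le> x * max (conv (Suc n)) (conv n) + y * max (conv (Suc n)) (conv n)"
      using x y by (intro add_mono mult_left_mono) auto
    ultimately show ?thesis
      unfolding M using x y by (simp add: pos_le_divide_eq pos_divide_le_eq algebra_simps)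
  qed
  show "eventually (\<lambda>n. min (conv (Suc n)) (conv n) \<le> ?M n) sequentially"
    using assms by eventually_elim (use bounds in blast)
  show "eventually (\<lambda>n. ?M n \<le> max (conv (Suc n)) (conv n)) sequentially"
    using assms by eventually_elim (use bounds in blast)
  note lims = LIMSEQ_Suc[OF conv_tendsto] conv_tendsto
  show "(\<lambda>n. min (conv (Suc n)) (conv n)) \<longlonglongrightarrow> s + cf_value a (\<lambda>_. b)"
    using tendsto_min[OF lims] by simp
  show "(\<lambda>n. max (conv (Suc n)) (conv n)) \<longlonglongrightarrow> s + cf_value a (\<lambda>_. b)"
    using tendsto_max[OF lims] by simp
qed

text \<open>Bounds valid for every convergent pass to the limit. Though crude, they suffice for
  positivity of \<open>y s\<close> and for \<open>y s / s\<close> tending to 1.\<close>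

lemma cf_value_bounds:
  shows "cf_value a (\<lambda>_. b) \<ge> 0" "cf_value a (\<lambda>_. b) \<le> a 1 / b"
proof -
  have lim: "cf_convergent a (\<lambda>_. b) \<longlonglongrightarrow> cf_value a (\<lambda>_. b)"
    using tendsto_diff[OF conv_tendsto tendsto_const, of s] by (simp add: conv_eq)
  show "cf_value a (\<lambda>_. b) \<ge> 0"
    using b_pos a_pos
    by (intro tendsto_lowerbound[OF lim] always_eventually)
       (auto simp: cf_convergent_def intro!: cf_aux_nonneg)
  show "cf_value a (\<lambda>_. b) \<le> a 1 / b"
    using b_pos a_pos
    by (intro tendsto_upperbound[OF lim] always_eventually allI)
       (auto simp: cf_convergent_def simp del: One_nat_def intro!: cf_aux_le)
qed

end

section \<open>The functional equation\<close>

text \<open>With \<open>w n = 2 * r * n - s\<close>, the quantity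
  \<open>a n - w (n - 1) * (2 * s + w n)\<close> is the constant
  \<open>(s + 1) * (s + 2 * r - 1)\<close>. Therefore the transformed recurrence keeps the
  coefficients \<open>a n\<close>, while \<open>2 * s\<close> grows by
  \<open>w (n + 1) - w (n - 1) = 4 * r\<close>.\<close>

lemma bauer_muir_rec:
  fixes r s :: real
  defines "a \<equiv> (\<lambda>n. (2 * real n - 1)\<^sup>2 * r\<^sup>2 - (r - 1)\<^sup>2)"
  shows "cf_rec a (2 * s) x y (Suc n) + (2 * r * real n - s) * cf_rec a (2 * s) x y n =
           cf_rec a (2 * (s + 2 * r)) (y - s * x) ((s + 2 * r) * y + (2 * r - 1) * x) n"
proof (induction n rule: induct_nat_012)
  case 0
  then show ?case by simp
next
  case 1
  then show ?case by (simp add: a_def algebra_simps power2_eq_square)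
next
  case (ge2 n)
  show ?case
    unfolding cf_rec.simps(3)[of _ _ _ _ n] ge2 [symmetric]
    by (simp add: a_def algebra_simps power2_eq_square)
qed

lemma cf_rec_scale: "cf_rec a b (c * x) (c * y) n = c * cf_rec a b x y n"
  by (induction a b x y n rule: cf_rec.induct) (simp_all add: algebra_simps)

context
  fixes r :: real and a :: "nat \<Rightarrow> real" and y :: "real \<Rightarrow> real"
  assumes r: "r > 1/2"
  defines "a \<equiv> (\<lambda>n. (2 * real n - 1)\<^sup>2 * r\<^sup>2 - (r - 1)\<^sup>2)"
  defines "y \<equiv> (\<lambda>s. s + cf_value a (\<lambda>_. 2 * s))"
begin

lemma positive_cf_brouncker:
  assumes "s > 0"
  shows "positive_cf a (2 * s) (2 * r)"
proof
  fix n :: nat assume n: "n > 0"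
  \<comment> \<open>A difference of squares; at \<open>n = 1\<close> the second factor is
    \<open>2 * r - 1\<close>, which is where \<open>r > 1/2\<close> enters.\<close>
  have a: "a n = (2 * (real n - 1) * r + 1) * (2 * real n * r - 1)"
    by (simp add: a_def algebra_simps power2_eq_square)
  have "2 * (real n - 1) * r + 1 > 0"
    using n r by (intro add_nonneg_pos mult_nonneg_nonneg) auto
  moreover have "2 * real n * r \<ge> 2 * r" using n r by simp
  then have "2 * real n * r - 1 > 0" using r by linarith
  ultimately show "a n > 0" unfolding a by simp
  have "a n \<le> ((2 * real n - 1) * r)\<^sup>2" by (simp add: a_def power_mult_distrib)
  also have "\<dots> \<le> (2 * r * real n)\<^sup>2"
    using n r by (intro power_mono mult_nonneg_nonneg) (auto simp: algebra_simps)
  finally show "a n \<le> (2 * r * real n)\<^sup>2" .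
qed (use assms r in auto)

lemma brouncker_functional_equation:
  assumes s: "s > 0"
  shows "y s * y (s + 2 * r) = (s + 1) * (s + 2 * r - 1)"
proof -
  define w where "w n = 2 * r * real (Suc n) - s" for n
  define l where "l = (s + 1) * (s + 2 * r - 1)"
  interpret s: positive_cf a "2 * s" s "2 * r" by (rule positive_cf_brouncker[OF s])
  interpret t: positive_cf a "2 * (s + 2 * r)" "s + 2 * r" "2 * r"
    by (rule positive_cf_brouncker) (use s r in simp)
  \<comment> \<open>The transformation sends the start values \<open>(1, s)\<close> to
    \<open>(0, l)\<close> and \<open>(0, 1)\<close> to \<open>(1, s + 2 * r)\<close>. Numerators at
    \<open>s\<close> thus become \<open>l\<close> times denominators at \<open>s + 2 * r\<close>,
    and denominators become numerators: the modified convergents are \<open>l\<close> over the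
    convergents at \<open>s + 2 * r\<close>.\<close>
  have num: "s.num (Suc (Suc n)) + w n * s.num (Suc n) = l * t.den (Suc n)" for n
  proof -
    have "(s + 2 * r) * s + (2 * r - 1) = l" by (simp add: l_def algebra_simps)
    then show ?thesis
      using bauer_muir_rec[of r s 1 s "Suc n"] cf_rec_scale[of a "2 * (s + 2 * r)" l 0 1 "Suc n"]
      unfolding a_def [symmetric] w_def s.num_def t.den_def by (simp del: cf_rec.simps)
  qed
  have den: "s.den (Suc (Suc n)) + w n * s.den (Suc n) = t.num (Suc n)" for n
    using bauer_muir_rec[of r s 0 1 "Suc n"]
    unfolding a_def [symmetric] w_def s.den_def t.num_def by (simp del: cf_rec.simps)
  \<comment> \<open>The modifiers can be negative at first, but not once \<open>n\<close> exceeds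
    \<open>s / (2 * r)\<close>.\<close>
  have "eventually (\<lambda>n. w n \<ge> 0) sequentially"
    using eventually_ge_at_top[of "nat \<lceil>s / (2 * r)\<rceil>"]
  proof eventually_elim
    case (elim n)
    then have "s / (2 * r) \<le> real (Suc n)" by linarith
    then show ?case using r by (simp add: w_def field_simps)
  qed
  then have "(\<lambda>n. (l * t.den (Suc n)) / t.num (Suc n)) \<longlonglongrightarrow> y s"
    unfolding y_def num [symmetric] den [symmetric] by (rule s.modified_convergent_tendsto)
  moreover have "t.conv \<longlonglongrightarrow> y (s + 2 * r)"
    unfolding y_def by (rule t.conv_tendsto)
  ultimately have "(\<lambda>n. (l * t.den (Suc n)) / t.num (Suc n) * t.conv n) \<longlonglongrightarrow> y s * y (s + 2 * r)"
    by (rule tendsto_mult)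
  moreover have "(l * t.den (Suc n)) / t.num (Suc n) * t.conv n = l" for n
  proof -
    have "t.conv n \<ge> s + 2 * r"
      unfolding t.conv_eq cf_convergent_def using t.b_pos t.a_pos by (simp add: cf_aux_nonneg)
    then have "t.conv n \<noteq> 0" using s r by linarith
    then have "t.num (Suc n) \<noteq> 0" unfolding t.conv_def by auto
    then show ?thesis using t.den_pos[of n] unfolding t.conv_def by (simp del: t.den_simps t.num_simps)
  qed
  ultimately have "(\<lambda>_. l) \<longlonglongrightarrow> y s * y (s + 2 * r)" by simp
  then show ?thesis by (simp add: l_def LIMSEQ_const_iff)
qed

lemma brouncker_bounds:
  assumes "s > 0"
  shows "y s \<ge> s" "y s \<le> s + (2 * r - 1) / (2 * s)"
proof -
  interpret positive_cf a "2 * s" s "2 * r" by (rule positive_cf_brouncker[OF assms])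
  have "a 1 = 2 * r - 1" by (simp add: a_def power2_eq_square algebra_simps)
  then show "y s \<ge> s" "y s \<le> s + (2 * r - 1) / (2 * s)"
    using cf_value_bounds by (simp_all add: y_def)
qed

lemma brouncker_ratio_tendsto: "((\<lambda>s. y s / s) \<longlongrightarrow> 1) at_top"
proof (rule tendsto_sandwich)
  show "eventually (\<lambda>s. 1 \<le> y s / s) at_top"
    using eventually_gt_at_top[of 0] by eventually_elim (use brouncker_bounds in simp)
  show "eventually (\<lambda>s. y s / s \<le> 1 + (2 * r - 1) / (2 * s) / s) at_top"
    using eventually_gt_at_top[of 0]
  proof eventually_elim
    case (elim s)
    have "y s / s \<le> (s + (2 * r - 1) / (2 * s)) / s"
      using elim brouncker_bounds(2)[OF elim] by (intro divide_right_mono) auto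
    also have "\<dots> = 1 + (2 * r - 1) / (2 * s) / s"
      using elim by (simp add: add_divide_distrib)
    finally show ?case .
  qed
  show "((\<lambda>s. 1 + (2 * r - 1) / (2 * s) / s) \<longlongrightarrow> 1) at_top"
    by (rule tendsto_eq_intros tendsto_divide_0 filterlim_at_top_imp_at_infinity filterlim_ident
          filterlim_tendsto_pos_mult_at_top | simp)+
qed auto

end

section \<open>The formal solution\<close>

text \<open>Beyond the first \<open>n\<close> terms the series is \<open>x ^ n\<close> times the
  shifted series, whose sum is continuous at 0 and hence bounded nearby.\<close>

lemma has_fps_expansion_remainder:
  fixes f :: "'a :: {banach, real_normed_field} \<Rightarrow> 'a"
  assumes "f has_fps_expansion F"
  shows "(\<lambda>x. f x - (\<Sum>m<n. fps_nth F m * x ^ m)) \<in> O[nhds 0](\<lambda>x. x ^ n)"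
proof -
  define S where "S = fps_shift n F"
  \<comment> \<open>The formal difference of the two sides is zero, so the functions themselves
    agree near 0.\<close>
  define G where "G = F - (\<Sum>m<n. fps_const (fps_nth F m) * fps_X ^ m) - fps_X ^ n * S"
  have S: "eval_fps S has_fps_expansion S"
    using assms by (intro eval_fps_has_fps_expansion) (simp add: S_def has_fps_expansion_def)
  have "(\<lambda>x. f x - (\<Sum>m<n. fps_nth F m * x ^ m) - x ^ n * eval_fps S x) has_fps_expansion G"
    unfolding G_def by (intro fps_expansion_intros assms S)
  moreover have "G = 0"
    by (rule fps_ext)
       (auto simp: G_def S_def fps_sum_nth fps_X_power_mult_nth fps_X_power_nth if_distrib cong: if_cong)
  ultimately have eq: "eventually (\<lambda>x. x ^ n * eval_fps S x = f x - (\<Sum>m<n. fps_nth F m * x ^ m)) (nhds 0)"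
    by (auto simp: has_fps_expansion_def elim!: eventually_mono)
  have "(\<lambda>x. x ^ n * eval_fps S x) \<in> O[nhds 0](\<lambda>x. x ^ n * 1)"
  proof (rule landau_o.big.mult_left)
    have "isCont (eval_fps S) 0"
      using has_fps_expansion_imp_continuous[OF S, of UNIV] by simp
    then have "(eval_fps S \<longlongrightarrow> eval_fps S 0) (nhds 0)"
      by (simp add: continuous_at_imp_continuous_within isCont_def tendsto_nhds_iff)
    then show "eval_fps S \<in> O[nhds 0](\<lambda>_. 1)"
      by (intro bigoI_tendsto[of _ _ "eval_fps S 0"]) auto
  qed
  then show ?thesis
    unfolding landau_o.big.in_cong[OF eq] mult_1_right .
qed

text \<open>The Mercator series. At \<open>n = 0\<close> the coefficient is \<open>- 1 / 0\<close>,
  which is 0 in HOL, as required by \<open>ln 1 = 0\<close>.\<close>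

lemma has_fps_expansion_ln_linear:
  fixes c :: real
  shows "(\<lambda>x. ln (1 + c * x)) has_fps_expansion Abs_fps (\<lambda>n. - ((- c) ^ n) / real n)"
proof (rule has_fps_expansionI)
  have "((\<lambda>x. \<bar>c * x\<bar>) \<longlongrightarrow> \<bar>c * 0\<bar>) (nhds 0)"
    by (intro tendsto_intros filterlim_ident)
  then have "eventually (\<lambda>x. \<bar>c * x\<bar> < 1) (nhds 0)"
    by (rule order_tendstoD) simp
  then show "eventually (\<lambda>x. (\<lambda>n. fps_nth (Abs_fps (\<lambda>n. - ((- c) ^ n) / real n)) n * x ^ n) sums ln (1 + c * x)) (nhds 0)"
  proof eventually_elim
    case (elim x)
    have "(- (c * x)) ^ n = (- c) ^ n * x ^ n" for n
      by (simp only: mult_minus_left [symmetric] power_mult_distrib)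
    with ln_series'[OF elim] show ?case by simp
  qed
qed

text \<open>The negative binomial series. For \<open>x = 1 / u\<close> the function is
  \<open>1 / (u - c) ^ n\<close>, so this re-expands shifted inverse powers in
  \<open>1 / u\<close>.\<close>

lemma has_fps_expansion_shifted_reciprocal_power:
  fixes c :: real
  assumes "n > 0"
  shows "(\<lambda>x. (x / (1 - c * x)) ^ n) has_fps_expansion
           Abs_fps (\<lambda>j. if j < n then 0 else real ((j - 1) choose (n - 1)) * c ^ (j - n))"
proof -
  have "(\<lambda>x. x ^ n * inverse (\<Prod>i<n. 1 - c * x)) has_fps_expansion
          fps_X ^ n * inverse (\<Prod>i<n. 1 - fps_const c * fps_X)"
    by (intro fps_expansion_intros) (simp add: fps_power_zeroth)
  also have "(\<lambda>x. x ^ n * inverse (\<Prod>i<n. 1 - c * x)) = (\<lambda>x. (x / (1 - c * x)) ^ n)"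
    by (simp add: power_divide field_simps)
  also have "fps_X ^ n * inverse (\<Prod>i<n. 1 - fps_const c * fps_X) =
      Abs_fps (\<lambda>j. if j < n then 0 else real ((j - 1) choose (n - 1)) * c ^ (j - n))"
  proof (rule fps_ext)
    fix j
    have "j - 1 choose (j - n) = j - 1 choose (n - 1)" if "j \<ge> n"
      using that assms by (subst binomial_symmetric) auto
    then show "fps_nth (fps_X ^ n * inverse (\<Prod>i<n. 1 - fps_const c * fps_X)) j =
        fps_nth (Abs_fps (\<lambda>j. if j < n then 0 else real ((j - 1) choose (n - 1)) * c ^ (j - n))) j"
      using assms by (simp add: fps_X_power_mult_nth one_minus_const_fps_X_neg_power')
  qed
  finally show ?thesis .
qed

lemma sum_even_support:
  fixes f :: "nat \<Rightarrow> 'a :: comm_monoid_add"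
  assumes "\<And>i. odd i \<Longrightarrow> f i = 0"
  shows "(\<Sum>i\<le>2 * n. f i) = (\<Sum>k\<le>n. f (2 * k))"
  by (induction n) (simp_all add: assms)

section \<open>Euler numbers and quotients of hyperbolic cosines\<close>

definition cosh_fps :: "real \<Rightarrow> real fps" where
  "cosh_fps c = Abs_fps (\<lambda>n. if even n then c ^ n / fact n else 0)"

lemma cosh_fps_eq: "cosh_fps c = fps_compose fps_cosh_series (fps_const c * fps_X)"
  by (rule fps_ext) (simp add: cosh_fps_def fps_cosh_series_def)

lemma inverse_cosh_fps_nth: "fps_nth (inverse (cosh_fps c)) n = c ^ n * euler_num n / fact n"
proof -
  have "inverse (cosh_fps c) = fps_compose (inverse fps_cosh_series) (fps_const c * fps_X)"
    unfolding cosh_fps_eq by (subst fps_inverse_compose) (auto simp: fps_cosh_series_def)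
  then show ?thesis by (simp add: euler_num_def)
qed

text \<open>The coefficient of \<open>x ^ (2 * n) / fact (2 * n)\<close> in
  \<open>cosh (a * x) / cosh (b * x)\<close>; the theorem uses \<open>a = r - 1\<close> and
  \<open>b = r\<close>.\<close>

definition euler_sum :: "real \<Rightarrow> real \<Rightarrow> nat \<Rightarrow> real" where
  "euler_sum a b n =
     (\<Sum>k\<le>n. real ((2 * n) choose (2 * k)) * a ^ (2 * k) * b ^ (2 * (n - k)) * euler_num (2 * (n - k)))"

lemma euler_sum_eq: "euler_sum a b n = fact (2 * n) * fps_nth (cosh_fps a * inverse (cosh_fps b)) (2 * n)"
proof -
  have "fps_nth (cosh_fps a * inverse (cosh_fps b)) (2 * n) =
      (\<Sum>i\<le>2 * n. fps_nth (cosh_fps a) i * fps_nth (inverse (cosh_fps b)) (2 * n - i))"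
    by (simp add: fps_mult_nth atLeast0AtMost)
  also have "\<dots> = (\<Sum>k\<le>n. fps_nth (cosh_fps a) (2 * k) * fps_nth (inverse (cosh_fps b)) (2 * n - 2 * k))"
    by (rule sum_even_support) (simp add: cosh_fps_def)
  also have "fact (2 * n) * \<dots> = euler_sum a b n"
    unfolding euler_sum_def sum_distrib_left
  proof (rule sum.cong)
    fix k assume "k \<in> {..n}"
    then have k: "2 * k \<le> 2 * n" "2 * n - 2 * k = 2 * (n - k)" by auto
    show "fact (2 * n) * (fps_nth (cosh_fps a) (2 * k) * fps_nth (inverse (cosh_fps b)) (2 * n - 2 * k))
        = real ((2 * n) choose (2 * k)) * a ^ (2 * k) * b ^ (2 * (n - k)) * euler_num (2 * (n - k))"
      unfolding binomial_fact[OF k(1), where 'a = real] k(2) inverse_cosh_fps_nth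
      by (simp add: cosh_fps_def)
  qed simp
  finally show ?thesis ..
qed

text \<open>Multiply the quotient of the two cosh series by \<open>cosh_fps b\<close> again and
  compare even coefficients.\<close>

lemma euler_sum_convolution:
  "(\<Sum>n\<le>p. real ((2 * p) choose (2 * n)) * b ^ (2 * (p - n)) * euler_sum a b n) = a ^ (2 * p)"
proof -
  define H where "H = cosh_fps a * inverse (cosh_fps b)"
  have "fps_nth (cosh_fps b) 0 \<noteq> 0" by (simp add: cosh_fps_def)
  then have H: "H * cosh_fps b = cosh_fps a"
    unfolding H_def by (simp add: mult.assoc inverse_mult_eq_1)
  have "a ^ (2 * p) = fact (2 * p) * fps_nth (H * cosh_fps b) (2 * p)"
    unfolding H by (simp add: cosh_fps_def)
  also have "fps_nth (H * cosh_fps b) (2 * p) = (\<Sum>i\<le>2 * p. fps_nth H i * fps_nth (cosh_fps b) (2 * p - i))"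
    by (simp add: fps_mult_nth atLeast0AtMost)
  \<comment> \<open>Odd \<open>i\<close> drop out because \<open>2 * p - i\<close> is then odd and
    \<open>cosh_fps b\<close> is even; no parity of \<open>H\<close> has to be shown.\<close>
  also have "\<dots> = (\<Sum>i\<le>2 * p. if even i then fps_nth H i * fps_nth (cosh_fps b) (2 * p - i) else 0)"
    by (intro sum.cong) (auto simp: cosh_fps_def)
  also have "\<dots> = (\<Sum>n\<le>p. fps_nth H (2 * n) * fps_nth (cosh_fps b) (2 * p - 2 * n))"
    by (subst sum_even_support) auto
  also have "fact (2 * p) * \<dots> =
      (\<Sum>n\<le>p. real ((2 * p) choose (2 * n)) * b ^ (2 * (p - n)) * euler_sum a b n)"
    unfolding sum_distrib_left
  proof (rule sum.cong)
    fix n assume "n \<in> {..p}"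
    then have n: "2 * n \<le> 2 * p" "2 * p - 2 * n = 2 * (p - n)" by auto
    show "fact (2 * p) * (fps_nth H (2 * n) * fps_nth (cosh_fps b) (2 * p - 2 * n))
        = real ((2 * p) choose (2 * n)) * b ^ (2 * (p - n)) * euler_sum a b n"
      unfolding binomial_fact[OF n(1), where 'a = real] n(2)
      by (simp add: cosh_fps_def euler_sum_eq H_def)
  qed simp
  finally show ?thesis ..
qed

section \<open>The truncated exponent and its functional equation\<close>

definition log_coeff :: "real \<Rightarrow> nat \<Rightarrow> real" where
  "log_coeff r n = - euler_sum (r - 1) r n / (2 * real n)"

text \<open>The exponent of the theorem cut off after \<open>N\<close> terms, as a polynomial in
  \<open>x = 1 / s\<close>.\<close>

definition log_poly :: "real \<Rightarrow> nat \<Rightarrow> real \<Rightarrow> real" where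
  "log_poly r N x = (\<Sum>n=1..N. log_coeff r n * x ^ (2 * n))"

text \<open>This is half of the comparison of \<open>x ^ (2 * p)\<close> coefficients in the
  functional equation. Binomial absorption turns it into \<open>euler_sum_convolution\<close>, whose
  term for \<open>n = 0\<close> supplies \<open>r ^ (2 * p)\<close>.\<close>

lemma log_coeff_convolution:
  assumes "p > 0"
  shows "(\<Sum>n=1..p. log_coeff r n * real ((2 * p - 1) choose (2 * n - 1)) * r ^ (2 * (p - n)))
           = (r ^ (2 * p) - (r - 1) ^ (2 * p)) / (2 * real p)"
proof -
  have summand: "log_coeff r n * real ((2 * p - 1) choose (2 * n - 1)) * r ^ (2 * (p - n)) =
      - (real ((2 * p) choose (2 * n)) * r ^ (2 * (p - n)) * euler_sum (r - 1) r n) / (2 * real p)"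
    if "n \<in> {1..p}" for n
  proof -
    have n: "Suc (2 * n - 1) = 2 * n" "n > 0" using that by auto
    have "real (2 * n) * real ((2 * p) choose (2 * n)) = real (2 * p) * real ((2 * p - 1) choose (2 * n - 1))"
      using binomial_absorption[of "2 * n - 1" "2 * p"] unfolding n by (simp only: flip: of_nat_mult)
    then have "real ((2 * p - 1) choose (2 * n - 1)) / real n = real ((2 * p) choose (2 * n)) / real p"
      using n assms by (simp add: field_simps)
    then have "real ((2 * p - 1) choose (2 * n - 1)) / real n * (- euler_sum (r - 1) r n * r ^ (2 * (p - n)) / 2)
       = real ((2 * p) choose (2 * n)) / real p * (- euler_sum (r - 1) r n * r ^ (2 * (p - n)) / 2)"
      by simp
    then show ?thesis by (simp add: log_coeff_def mult_ac)
  qed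
  have "(\<Sum>n\<le>p. real ((2 * p) choose (2 * n)) * r ^ (2 * (p - n)) * euler_sum (r - 1) r n) =
      r ^ (2 * p) * euler_sum (r - 1) r 0 +
      (\<Sum>n=1..p. real ((2 * p) choose (2 * n)) * r ^ (2 * (p - n)) * euler_sum (r - 1) r n)"
  proof -
    have "{..p} = insert 0 {1..p}" by auto
    then show ?thesis by simp
  qed
  moreover have "euler_sum (r - 1) r 0 = 1"
    using euler_sum_convolution[of 0 r "r - 1"] by simp
  ultimately have "(\<Sum>n=1..p. real ((2 * p) choose (2 * n)) * r ^ (2 * (p - n)) * euler_sum (r - 1) r n)
      = (r - 1) ^ (2 * p) - r ^ (2 * p)"
    by (simp add: euler_sum_convolution)
  moreover have "(\<Sum>n=1..p. log_coeff r n * real ((2 * p - 1) choose (2 * n - 1)) * r ^ (2 * (p - n))) =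
      - (\<Sum>n=1..p. real ((2 * p) choose (2 * n)) * r ^ (2 * (p - n)) * euler_sum (r - 1) r n) / (2 * real p)"
    by (simp add: summand sum_divide_distrib sum_negf del: One_nat_def)
  ultimately show ?thesis by simp
qed

text \<open>For \<open>x = 1 / u\<close> the arguments are \<open>1 / (u - r)\<close> and
  \<open>1 / (u + r)\<close>, so this is the logarithmic functional equation up to an error. All
  coefficients below degree \<open>2 * N + 1\<close> cancel.\<close>

lemma log_poly_functional_equation:
  "(\<lambda>x. log_poly r N (x / (1 - r * x)) + log_poly r N (x / (1 + r * x)) -
     (ln (1 + (r - 1) * x) + ln (1 - (r - 1) * x) - ln (1 + r * x) - ln (1 - r * x)))
   \<in> O[nhds 0](\<lambda>x. x ^ (2 * N + 1))"
proof -
  define Q where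
    "Q c n = Abs_fps (\<lambda>j. if j < n then 0 else real ((j - 1) choose (n - 1)) * c ^ (j - n))"
    for c :: real and n
  define l where "l c = Abs_fps (\<lambda>n. - ((- c) ^ n) / real n)" for c :: real
  define G where "G = (\<Sum>n=1..N. fps_const (log_coeff r n) * Q r (2 * n)) +
    (\<Sum>n=1..N. fps_const (log_coeff r n) * Q (- r) (2 * n)) -
    (l (r - 1) + l (- (r - 1)) - l r - l (- r))"
  have Q: "(\<lambda>x. (x / (1 - c * x)) ^ (2 * n)) has_fps_expansion Q c (2 * n)" if "n \<in> {1..N}" for c n
    unfolding Q_def using that by (intro has_fps_expansion_shifted_reciprocal_power) auto
  have l: "(\<lambda>x. ln (1 + c * x)) has_fps_expansion l c" for c
    unfolding l_def by (rule has_fps_expansion_ln_linear)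
  have "(\<lambda>x. log_poly r N (x / (1 - r * x)) + log_poly r N (x / (1 - (- r) * x)) -
     (ln (1 + (r - 1) * x) + ln (1 + (- (r - 1)) * x) - ln (1 + r * x) - ln (1 + (- r) * x)))
     has_fps_expansion G"
    unfolding G_def log_poly_def by (intro fps_expansion_intros Q l)
  moreover have "fps_nth G j = 0" if j: "j < 2 * N + 1" for j
  proof -
    have G_nth: "fps_nth G j = (\<Sum>n=1..N. log_coeff r n * (fps_nth (Q r (2 * n)) j + fps_nth (Q (- r) (2 * n)) j))
       - (- ((- (r - 1)) ^ j) - (r - 1) ^ j + (- r) ^ j + r ^ j) / real j"
      by (simp add: G_def l_def fps_sum_nth sum.distrib distrib_left add_divide_distrib diff_divide_distrib)
    show ?thesis
    proof (cases "odd j")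
      \<comment> \<open>Odd coefficients cancel between \<open>r\<close> and \<open>- r\<close>,
        since every \<open>2 * n\<close> is even, and likewise between the paired
        logarithms.\<close>
      case True
      then have "fps_nth (Q r (2 * n)) j + fps_nth (Q (- r) (2 * n)) j = 0" for n
        by (simp add: Q_def)
      with True show ?thesis unfolding G_nth by (simp del: minus_diff_eq)
    next
      case False
      then obtain p where p: "j = 2 * p" by (auto elim: evenE)
      show ?thesis
      proof (cases "p = 0")
        case True
        with p show ?thesis unfolding G_nth by (simp add: Q_def)
      next
        case p0: False
        \<comment> \<open>\<open>Q\<close> starts in degree \<open>2 * n\<close>, so only
          \<open>n\<close> up to \<open>p\<close> contribute; as \<open>p\<close> is at most
          \<open>N\<close>, the truncation loses nothing.\<close>
        have "(\<Sum>n=1..N. log_coeff r n * (fps_nth (Q r (2 * n)) j + fps_nth (Q (- r) (2 * n)) j)) =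
            (\<Sum>n=1..p. log_coeff r n * (fps_nth (Q r (2 * n)) j + fps_nth (Q (- r) (2 * n)) j))"
          using j p by (intro sum.mono_neutral_right) (auto simp: Q_def)
        also have "\<dots> = (\<Sum>n=1..p. 2 * (log_coeff r n * real ((2 * p - 1) choose (2 * n - 1)) * r ^ (2 * (p - n))))"
        proof (intro sum.cong refl)
          fix n assume "n \<in> {1..p}"
          then have "\<not> j < 2 * n" "j - 2 * n = 2 * (p - n)" using p by auto
          then show "log_coeff r n * (fps_nth (Q r (2 * n)) j + fps_nth (Q (- r) (2 * n)) j) =
              2 * (log_coeff r n * real ((2 * p - 1) choose (2 * n - 1)) * r ^ (2 * (p - n)))"
            by (simp add: Q_def p)
        qed
        also have "\<dots> = 2 * ((r ^ (2 * p) - (r - 1) ^ (2 * p)) / (2 * real p))"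
          unfolding sum_distrib_left [symmetric] using p0 by (subst log_coeff_convolution) simp_all
        finally show ?thesis unfolding G_nth using p p0
          by (simp add: field_simps del: minus_diff_eq)
      qed
    qed
  qed
  ultimately have "(\<lambda>x. log_poly r N (x / (1 - r * x)) + log_poly r N (x / (1 - (- r) * x)) -
     (ln (1 + (r - 1) * x) + ln (1 + (- (r - 1)) * x) - ln (1 + r * x) - ln (1 + (- r) * x)))
     \<in> O[nhds 0](\<lambda>x. x ^ (2 * N + 1))"
    using has_fps_expansion_remainder[of _ G "2 * N + 1"] by fastforce
  then show ?thesis
    by (simp only: mult_minus_left add_uminus_conv_diff diff_minus_eq_add)
qed

section \<open>Asymptotic expansions\<close>

lemma smallo_one_over_power:
  fixes f :: "real \<Rightarrow> real"
  assumes "f \<in> O[at_top](\<lambda>s. 1 / s ^ m)" "n < m"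
  shows "f \<in> o[at_top](\<lambda>s. 1 / s ^ n)"
proof -
  obtain d where m: "m = Suc (n + d)" using less_imp_Suc_add[OF assms(2)] by blast
  have "(\<lambda>s::real. 1 / s ^ Suc d) \<in> o[at_top](\<lambda>_. 1)"
  proof (rule smalloI_tendsto)
    have "filterlim (\<lambda>s::real. s ^ Suc d) at_infinity at_top"
      by (intro filterlim_at_top_imp_at_infinity filterlim_pow_at_top filterlim_ident) simp
    then show "((\<lambda>s::real. 1 / s ^ Suc d / 1) \<longlongrightarrow> 0) at_top"
      unfolding div_by_1 by (rule tendsto_divide_0[OF tendsto_const])
  qed simp
  then have "(\<lambda>s::real. 1 / s ^ Suc d * (1 / s ^ n)) \<in> o[at_top](\<lambda>s. 1 * (1 / s ^ n))"
    by (rule landau_o.small.mult_right)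
  then have "(\<lambda>s::real. 1 / s ^ m) \<in> o[at_top](\<lambda>s. 1 / s ^ n)"
    by (simp add: m power_add mult_ac)
  with assms(1) show ?thesis
    by (rule landau_o.big_small_trans)
qed

text \<open>Solving \<open>D (u - r) + D (u + r) = e u\<close> backwards from infinity gives
  \<open>D s\<close> as the alternating sum of the values \<open>e (s + r + 2 * r * k)\<close>.\<close>
lemma decay_from_shift_sum:
  fixes D :: "real \<Rightarrow> real"
  assumes r: "r > 0" and D: "(D \<longlongrightarrow> 0) at_top"
    and shift: "(\<lambda>u. D (u - r) + D (u + r)) \<in> O[at_top](\<lambda>u. 1 / u ^ (m + 2))"
  shows "D \<in> O[at_top](\<lambda>s. 1 / s ^ m)"
proof -
  obtain C where C: "C > 0" and
    "eventually (\<lambda>u. norm (D (u - r) + D (u + r)) \<le> C * norm (1 / u ^ (m + 2))) at_top"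
    using landau_o.bigE[OF shift] by blast
  then obtain u0 where u0: "\<And>u. u \<ge> u0 \<Longrightarrow> \<bar>D (u - r) + D (u + r)\<bar> \<le> C * \<bar>1 / u ^ (m + 2)\<bar>"
    by (auto simp: eventually_at_top_linorder)
  define S where "S = (\<Sum>k. inverse ((real (Suc k))\<^sup>2))"
  have summable: "summable (\<lambda>k. inverse ((real (Suc k))\<^sup>2))"
    using inverse_power_summable[of 2, where 'a = real] by (subst summable_Suc_iff) auto
  have "\<bar>D s\<bar> \<le> C / r\<^sup>2 * S * (1 / s ^ m)" if s: "s > 0" "s \<ge> u0" for s
  proof -
    have step: "\<bar>D (s + 2 * r * real k) + D (s + 2 * r * real (Suc k))\<bar>
        \<le> C / r\<^sup>2 * (1 / s ^ m) * inverse ((real (Suc k))\<^sup>2)" for k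
    proof -
      define u where "u = s + r + 2 * r * real k"
      \<comment> \<open>The first bound yields the decay in \<open>s\<close> from \<open>m\<close>
        factors of \<open>u\<close>; the second makes the remaining two factors summable over
        \<open>k\<close>. This is the source of the loss of two orders.\<close>
      have us: "u \<ge> s" "u \<ge> r * real (Suc k)" using r s by (auto simp: u_def algebra_simps)
      then have "s ^ m * (r * real (Suc k))\<^sup>2 \<le> u ^ m * u\<^sup>2"
        using s r by (intro mult_mono power_mono) auto
      moreover have "0 < s ^ m * (r * real (Suc k))\<^sup>2" using s r by simp
      ultimately have "1 / u ^ (m + 2) \<le> 1 / (s ^ m * (r * real (Suc k))\<^sup>2)"
        unfolding power_add by (intro frac_le; (assumption | simp))
      moreover have "u > 0" using us s by simp
      moreover have "\<bar>D (u - r) + D (u + r)\<bar> \<le> C * \<bar>1 / u ^ (m + 2)\<bar>"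
        using us s by (intro u0) simp
      ultimately have "\<bar>D (u - r) + D (u + r)\<bar> \<le> C * (1 / (s ^ m * (r * real (Suc k))\<^sup>2))"
        using C mult_left_mono[of "1 / u ^ (m + 2)" "1 / (s ^ m * (r * real (Suc k))\<^sup>2)" C]
        by (simp del: of_nat_Suc power_Suc)
      also have "u - r = s + 2 * r * real k" by (simp add: u_def)
      also have "u + r = s + 2 * r * real (Suc k)" by (simp add: u_def algebra_simps)
      also have "C * (1 / (s ^ m * (r * real (Suc k))\<^sup>2)) =
          C / r\<^sup>2 * (1 / s ^ m) * inverse ((real (Suc k))\<^sup>2)"
        by (simp add: power_mult_distrib divide_inverse mult_ac del: of_nat_Suc)
      finally show ?thesis .
    qed
    \<comment> \<open>Repeated triangle inequality along the points \<open>s + 2 * r * k\<close>;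
      the last term vanishes in the limit because \<open>D\<close> tends to 0.\<close>
    have partial: "\<bar>D s\<bar> \<le> C / r\<^sup>2 * (1 / s ^ m) * (\<Sum>k<n. inverse ((real (Suc k))\<^sup>2))
        + \<bar>D (s + 2 * r * real n)\<bar>" for n
    proof (induction n)
      case (Suc n)
      then show ?case using step[of n] by (simp add: distrib_left)
    qed simp
    have "C / r\<^sup>2 * (1 / s ^ m) * (\<Sum>k<n. inverse ((real (Suc k))\<^sup>2)) \<le> C / r\<^sup>2 * (1 / s ^ m) * S" for n
      unfolding S_def using C s by (intro mult_left_mono sum_le_suminf summable) auto
    then have bound: "\<bar>D s\<bar> \<le> C / r\<^sup>2 * (1 / s ^ m) * S + \<bar>D (s + 2 * r * real n)\<bar>" for n
      using partial[of n] order_trans add_right_mono by blast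
    have "filterlim (\<lambda>n. s + 2 * r * real n) at_top sequentially"
      using r by (intro filterlim_tendsto_add_at_top[OF tendsto_const]
        filterlim_tendsto_pos_mult_at_top[OF tendsto_const] filterlim_real_sequentially) auto
    then have "(\<lambda>n. D (s + 2 * r * real n)) \<longlonglongrightarrow> 0"
      by (rule filterlim_compose[OF D])
    then have "(\<lambda>n. C / r\<^sup>2 * (1 / s ^ m) * S + \<bar>D (s + 2 * r * real n)\<bar>) \<longlonglongrightarrow>
        C / r\<^sup>2 * (1 / s ^ m) * S + \<bar>0\<bar>"
      by (intro tendsto_intros)
    then have "\<bar>D s\<bar> \<le> C / r\<^sup>2 * (1 / s ^ m) * S + \<bar>0\<bar>"
      using bound by (intro LIMSEQ_le_const) auto
    then show ?thesis by (simp add: mult_ac)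
  qed
  then show ?thesis
    by (intro bigoI[of _ "C / r\<^sup>2 * S"] eventually_mono[OF eventually_ge_at_top[of "max 1 u0"]]) auto
qed

text \<open>The terms of degree between \<open>N\<close> and \<open>M\<close> are themselves
  \<open>o(1 / s ^ N)\<close>, so any longer truncation may be used, in particular one of even
  degree.\<close>

lemma has_asymp_expansionI:
  assumes "\<And>N. \<exists>M\<ge>N. (\<lambda>s. f s - (\<Sum>m\<le>M. fps_nth A m / s ^ m)) \<in> o[at_top](\<lambda>s. 1 / s ^ N)"
  shows "has_asymp_expansion f A"
  unfolding has_asymp_expansion_def
proof
  fix N
  obtain M where M: "M \<ge> N" "(\<lambda>s. f s - (\<Sum>m\<le>M. fps_nth A m / s ^ m)) \<in> o[at_top](\<lambda>s. 1 / s ^ N)"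
    using assms by blast
  have "(\<lambda>s. fps_nth A m * (1 / s ^ m)) \<in> o[at_top](\<lambda>s. 1 / s ^ N)" if "m \<in> {N<..M}" for m
    using that by (intro smallo_one_over_power[of _ m] bigoI[of _ "\<bar>fps_nth A m\<bar>"]) (auto simp: abs_mult)
  then have "(\<lambda>s. \<Sum>m\<in>{N<..M}. fps_nth A m / s ^ m) \<in> o[at_top](\<lambda>s. 1 / s ^ N)"
    by (intro big_sum_in_smallo) simp
  from sum_in_smallo(1)[OF M(2) this]
  have "(\<lambda>s. f s - (\<Sum>m\<le>M. fps_nth A m / s ^ m) + (\<Sum>m\<in>{N<..M}. fps_nth A m / s ^ m))
      \<in> o[at_top](\<lambda>s. 1 / s ^ N)" .
  moreover have "{..M} = {..N} \<union> {N<..M}" using M(1) by auto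
  then have "(\<Sum>m\<le>M. fps_nth A m / s ^ m) = (\<Sum>m\<le>N. fps_nth A m / s ^ m) + (\<Sum>m\<in>{N<..M}. fps_nth A m / s ^ m)" for s
    by (simp only:) (rule sum.union_disjoint, auto)
  ultimately show "(\<lambda>s. f s - (\<Sum>m\<le>N. fps_nth A m / s ^ m)) \<in> o[at_top](\<lambda>s. 1 / s ^ N)"
    by simp
qed

lemma filterlim_inverse_at_top_nhds_0: "filterlim (\<lambda>s::real. 1 / s) (nhds 0) at_top"
  by (intro tendsto_divide_0[OF tendsto_const] filterlim_at_top_imp_at_infinity filterlim_ident)

lemma fps_power_nth_cong:
  fixes A B :: "'a :: comm_semiring_1 fps"
  assumes "\<And>j. j \<le> N \<Longrightarrow> fps_nth A j = fps_nth B j" "m \<le> N"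
  shows "fps_nth (A ^ i) m = fps_nth (B ^ i) m"
  using assms(2)
proof (induction i arbitrary: m)
  case (Suc i)
  then show ?case by (auto simp: fps_mult_nth assms(1) intro!: sum.cong)
qed simp

text \<open>Three errors are added: \<open>exp\<close> against its Taylor polynomial at
  \<open>L s\<close>, powers of \<open>L s\<close> against powers of the truncation
  \<open>p (1 / s)\<close>, and the resulting polynomial against the truncated composed
  series.\<close>

lemma has_asymp_expansion_exp:
  assumes L: "has_asymp_expansion L F" and F0: "fps_nth F 0 = 0"
  shows "has_asymp_expansion (\<lambda>s. exp (L s)) (fps_exp_of F)"
  unfolding has_asymp_expansion_def
proof
  fix N
  define A where "A = (\<Sum>m\<le>N. fps_const (fps_nth F m) * fps_X ^ m)"
  define p where "p x = (\<Sum>m\<le>N. fps_nth F m * x ^ m)" for x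
  define E where "E = (\<Sum>i\<le>N. fps_const (1 / fact i) * (\<Prod>j<i. A))"
  let ?o = "o[at_top](\<lambda>s::real. 1 / s ^ N)"
  have A: "fps_nth A m = fps_nth F m" if "m \<le> N" for m
    using that by (simp add: A_def fps_sum_nth fps_X_power_nth if_distrib cong: if_cong)
  have "fps_nth E m = fps_nth (fps_exp_of F) m" if m: "m \<le> N" for m
  proof -
    have "fps_nth E m = (\<Sum>i\<le>N. 1 / fact i * fps_nth (A ^ i) m)"
      by (simp add: E_def fps_sum_nth)
    also have "\<dots> = (\<Sum>i\<le>N. 1 / fact i * fps_nth (F ^ i) m)"
      using fps_power_nth_cong[OF A m] by simp
    \<comment> \<open>Without a constant term, \<open>F ^ i\<close> has no coefficients below degree
      \<open>i\<close>.\<close>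
    also have "\<dots> = (\<Sum>i\<le>m. 1 / fact i * fps_nth (F ^ i) m)"
      using m startsby_zero_power_prefix[OF F0] by (intro sum.mono_neutral_right) auto
    finally show ?thesis
      by (simp add: fps_exp_of_def fps_compose_nth atLeast0AtMost)
  qed
  then have poly: "(\<Sum>m<Suc N. fps_nth E m * x ^ m) = (\<Sum>m\<le>N. fps_nth (fps_exp_of F) m * x ^ m)" for x
    by (intro sum.cong) auto
  have p: "p has_fps_expansion A"
    unfolding p_def A_def by (intro fps_expansion_intros)
  then have "(\<lambda>x. \<Sum>i\<le>N. 1 / fact i * (\<Prod>j<i. p x)) has_fps_expansion E"
    unfolding E_def by (intro fps_expansion_intros)
  from has_fps_expansion_remainder[OF this, of "Suc N"]
  have "(\<lambda>x. (\<Sum>i\<le>N. p x ^ i / fact i) - (\<Sum>m\<le>N. fps_nth (fps_exp_of F) m * x ^ m))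
      \<in> O[nhds 0](\<lambda>x. x ^ Suc N)"
    by (simp add: poly del: sum.lessThan_Suc)
  from landau_o.big.compose[OF this filterlim_inverse_at_top_nhds_0]
  have 1: "(\<lambda>s. (\<Sum>i\<le>N. p (1 / s) ^ i / fact i) - (\<Sum>m\<le>N. fps_nth (fps_exp_of F) m / s ^ m)) \<in> ?o"
    by (intro smallo_one_over_power[of _ "Suc N"]) (simp_all add: power_one_over)

  have Lp: "(\<lambda>s. L s - p (1 / s)) \<in> ?o"
    using L unfolding has_asymp_expansion_def p_def by (simp add: power_one_over)
  have "L \<in> o[at_top](\<lambda>s. 1)"
    using L[unfolded has_asymp_expansion_def, rule_format, of 0] by (simp add: F0)
  then have L0: "(L \<longlongrightarrow> 0) at_top"
    by (auto dest: smalloD_tendsto)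
  then have L_bounded: "L \<in> O[at_top](\<lambda>_. 1)"
    by (intro bigoI_tendsto[of _ _ 0]) auto
  have "(p \<longlongrightarrow> p 0) (nhds 0)"
    unfolding p_def by (intro tendsto_intros filterlim_ident)
  then have "((\<lambda>s. p (1 / s)) \<longlongrightarrow> p 0) at_top"
    by (rule filterlim_compose[OF _ filterlim_inverse_at_top_nhds_0])
  then have p_bounded: "(\<lambda>s. p (1 / s)) \<in> O[at_top](\<lambda>_. 1)"
    by (intro bigoI_tendsto[of _ _ "p 0"]) auto
  have powers: "(\<lambda>s. L s ^ i - p (1 / s) ^ i) \<in> ?o" for i
  proof (induction i)
    case (Suc i)
    \<comment> \<open>Split \<open>L ^ (i + 1) - p ^ (i + 1)\<close> as
      \<open>L ^ i * (L - p) + p * (L ^ i - p ^ i)\<close>, with bounded cofactors.\<close>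
    have "(\<lambda>s. L s ^ i * (L s - p (1 / s))) \<in> o[at_top](\<lambda>s. 1 ^ i * (1 / s ^ N))"
      by (intro landau_o.big_small_mult landau_o.big_power L_bounded Lp)
    moreover have "(\<lambda>s. p (1 / s) * (L s ^ i - p (1 / s) ^ i)) \<in> o[at_top](\<lambda>s. 1 * (1 / s ^ N))"
      by (intro landau_o.big_small_mult p_bounded Suc.IH)
    ultimately have "(\<lambda>s. L s ^ i * (L s - p (1 / s)) + p (1 / s) * (L s ^ i - p (1 / s) ^ i)) \<in> ?o"
      by (intro sum_in_smallo) simp_all
    then show ?case by (simp add: algebra_simps)
  qed simp
  have "(\<lambda>s. \<Sum>i\<le>N. 1 / fact i * (L s ^ i - p (1 / s) ^ i)) \<in> ?o"
    by (intro big_sum_in_smallo) (simp add: powers)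
  then have 2: "(\<lambda>s. (\<Sum>i\<le>N. L s ^ i / fact i) - (\<Sum>i\<le>N. p (1 / s) ^ i / fact i)) \<in> ?o"
    by (simp add: right_diff_distrib sum_subtractf)

  \<comment> \<open>This order of decay makes the Taylor remainder of \<open>exp\<close>, of size
    \<open>L s ^ (N + 1)\<close>, negligible.\<close>
  have "L \<in> O[at_top](\<lambda>s. 1 / s)"
  proof -
    have "(\<lambda>s. L s - fps_nth F 1 / s) \<in> O[at_top](\<lambda>s. 1 / s)"
      using L[unfolded has_asymp_expansion_def, rule_format, of 1]
      by (intro landau_o.small_imp_big) (simp add: F0)
    moreover have "(\<lambda>s. fps_nth F 1 / s) \<in> O[at_top](\<lambda>s. 1 / s)"
      by (intro bigoI[of _ "\<bar>fps_nth F 1\<bar>"]) (simp add: abs_mult)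
    ultimately have "(\<lambda>s. (L s - fps_nth F 1 / s) + fps_nth F 1 / s) \<in> O[at_top](\<lambda>s. 1 / s)"
      by (rule sum_in_bigo)
    then show ?thesis by simp
  qed
  from landau_o.big_power[OF this, of "Suc N"]
  have L_power: "(\<lambda>s. L s ^ Suc N) \<in> O[at_top](\<lambda>s. 1 / s ^ Suc N)"
    by (simp add: power_one_over)
  have "(\<lambda>x::real. exp x - (\<Sum>i<Suc N. fps_nth (fps_exp 1) i * x ^ i)) \<in> O[nhds 0](\<lambda>x. x ^ Suc N)"
    by (intro has_fps_expansion_remainder fps_expansion_intros)
  from landau_o.big.compose[OF this L0] L_power
  have "(\<lambda>s. exp (L s) - (\<Sum>i<Suc N. fps_nth (fps_exp 1) i * L s ^ i)) \<in> O[at_top](\<lambda>s. 1 / s ^ Suc N)"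
    by (rule landau_o.big_trans)
  then have 3: "(\<lambda>s. exp (L s) - (\<Sum>i\<le>N. L s ^ i / fact i)) \<in> ?o"
    by (intro smallo_one_over_power[of _ "Suc N"]) (simp_all add: lessThan_Suc_atMost)

  from sum_in_smallo(1)[OF 3 sum_in_smallo(1)[OF 2 1]]
  show "(\<lambda>s. exp (L s) - (\<Sum>m\<le>N. fps_nth (fps_exp_of F) m / s ^ m)) \<in> ?o"
    by simp
qed

section \<open>The expansion of the continued fraction\<close>

text \<open>Keeping \<open>N + 1\<close> terms leaves an error of order \<open>2 * N + 3\<close> in
  the functional equation, and \<open>decay_from_shift_sum\<close> gives up two orders.\<close>

lemma brouncker_log_expansion:
  fixes r :: real
  assumes r: "r > 1/2"
  defines "y \<equiv> (\<lambda>s. s + cf_value (\<lambda>n. (2 * real n - 1)\<^sup>2 * r\<^sup>2 - (r - 1)\<^sup>2) (\<lambda>_. 2 * s))"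
  shows "(\<lambda>s. ln (y s / s) - log_poly r (Suc N) (1 / s)) \<in> O[at_top](\<lambda>s. 1 / s ^ (2 * N + 1))"
proof (rule decay_from_shift_sum)
  show "r > 0" using r by simp
  define P where "P = log_poly r (Suc N)"
  define h where "h x = ln (1 + (r - 1) * x) + ln (1 - (r - 1) * x) - ln (1 + r * x) - ln (1 - r * x)" for x
  have "((\<lambda>s. ln (y s / s)) \<longlongrightarrow> ln 1) at_top"
    unfolding y_def by (intro tendsto_ln brouncker_ratio_tendsto[OF r]) simp
  moreover have "(P \<longlongrightarrow> P 0) (nhds 0)"
    unfolding P_def log_poly_def by (intro tendsto_intros filterlim_ident)
  then have "((\<lambda>s. P (1 / s)) \<longlongrightarrow> P 0) at_top"
    by (rule filterlim_compose[OF _ filterlim_inverse_at_top_nhds_0])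
  moreover have "P 0 = 0"
    unfolding P_def log_poly_def by (intro sum.neutral) auto
  ultimately show "((\<lambda>s. ln (y s / s) - log_poly r (Suc N) (1 / s)) \<longlongrightarrow> 0) at_top"
    unfolding P_def [symmetric] by (auto intro: tendsto_eq_intros)

  have "eventually (\<lambda>u. ln (y (u - r) / (u - r)) - P (1 / (u - r)) +
          (ln (y (u + r) / (u + r)) - P (1 / (u + r))) =
          - (P (1 / u / (1 - r * (1 / u))) + P (1 / u / (1 + r * (1 / u))) - h (1 / u))) at_top"
    using eventually_gt_at_top[of "r + 1"]
  proof eventually_elim
    case (elim u)
    then have u: "u > 0" "u - r > 0" "u + r > 0" "u + (r - 1) > 0" "u - (r - 1) > 0"
      using r by auto
    have pos: "y (u - r) > 0" "y (u + r) > 0"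
      using brouncker_bounds(1)[OF r u(2)] brouncker_bounds(1)[OF r u(3)] u unfolding y_def by linarith+
    have feq: "y (u - r) * y (u + r) = (u + (r - 1)) * (u - (r - 1))"
      \<comment> \<open>Taken at \<open>s = u - r\<close>, which centres the two arguments around
        \<open>u\<close>.\<close>
      using brouncker_functional_equation[OF r u(2)] unfolding y_def by (simp add: algebra_simps)
    have "ln (y (u - r) / (u - r)) + ln (y (u + r) / (u + r)) =
        ln (y (u - r) * y (u + r)) - ln (u - r) - ln (u + r)"
      using pos u by (simp add: ln_div ln_mult)
    also have "\<dots> = ln (u + (r - 1)) + ln (u - (r - 1)) - ln (u + r) - ln (u - r)"
      unfolding feq using u by (simp add: ln_mult)
    also have "\<dots> = h (1 / u)"
    proof -
      \<comment> \<open>In \<open>h (1 / u)\<close> the terms \<open>ln u\<close> cancel: two come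
        with each sign.\<close>
      have "1 + c * (1 / u) = (u + c) / u" "1 - c * (1 / u) = (u - c) / u" for c
        using u by (simp_all add: field_simps)
      then show ?thesis using u by (simp add: h_def ln_div)
    qed
    finally have "ln (y (u - r) / (u - r)) + ln (y (u + r) / (u + r)) = h (1 / u)" .
    moreover have "1 / u / (1 - r * (1 / u)) = 1 / (u - r)" "1 / u / (1 + r * (1 / u)) = 1 / (u + r)"
      using u by (simp_all add: field_simps)
    ultimately show ?case by simp
  qed
  note eq = this
  have "(\<lambda>x. P (x / (1 - r * x)) + P (x / (1 + r * x)) - h x) \<in> O[nhds 0](\<lambda>x. x ^ (2 * Suc N + 1))"
    unfolding P_def h_def by (rule log_poly_functional_equation)
  from landau_o.big.compose[OF this filterlim_inverse_at_top_nhds_0]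
  have "(\<lambda>u. - (P (1 / u / (1 - r * (1 / u))) + P (1 / u / (1 + r * (1 / u))) - h (1 / u)))
      \<in> O[at_top](\<lambda>u. 1 / u ^ (2 * N + 1 + 2))"
    unfolding landau_o.big.uminus_in_iff by (simp add: power_one_over)
  then show "(\<lambda>u. ln (y (u - r) / (u - r)) - log_poly r (Suc N) (1 / (u - r)) +
          (ln (y (u + r) / (u + r)) - log_poly r (Suc N) (1 / (u + r))))
      \<in> O[at_top](\<lambda>u. 1 / u ^ (2 * N + 1 + 2))"
    unfolding P_def [symmetric] landau_o.big.in_cong[OF eq] .
qed

theorem theorem10:
  fixes r :: real
  assumes "r > 1/2"
  defines "y \<equiv> (\<lambda>s::real. s + cf_value
              (\<lambda>n. (2 * real n - 1)^2 * r^2 - (r - 1)^2) (\<lambda>n. 2 * s))"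
  defines "c \<equiv> (\<lambda>n::nat. - (\<Sum>k\<le>n. real ((2*n) choose (2*k)) * (r - 1)^(2*k)
                     * r^(2*(n - k)) * euler_num (2*(n - k))) / (2 * real n))"
  defines "F \<equiv> Abs_fps (\<lambda>j. if even j \<and> j > 0 then c (j div 2) else 0)"
  shows "has_asymp_expansion (\<lambda>s. y s / s) (fps_exp_of F)"
proof -
  have c: "c n = log_coeff r n" for n
    by (simp add: c_def log_coeff_def euler_sum_def)
  have F: "(\<Sum>m\<le>2 * M. fps_nth F m / s ^ m) = log_poly r M (1 / s)" for M s
  proof -
    have "(\<Sum>m\<le>2 * M. fps_nth F m / s ^ m) = (\<Sum>n\<le>M. fps_nth F (2 * n) / s ^ (2 * n))"
      by (rule sum_even_support) (simp add: F_def)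
    also have "\<dots> = (\<Sum>n=1..M. fps_nth F (2 * n) / s ^ (2 * n))"
      by (rule sum.mono_neutral_right) (auto simp: F_def not_less_eq_eq)
    also have "\<dots> = log_poly r M (1 / s)"
      unfolding log_poly_def by (intro sum.cong) (auto simp: F_def c power_one_over)
    finally show ?thesis .
  qed
  have "has_asymp_expansion (\<lambda>s. ln (y s / s)) F"
  proof (rule has_asymp_expansionI)
    fix N
    \<comment> \<open>Truncating at degree \<open>2 * (N + 1)\<close> gives an error of order
      \<open>2 * N + 1\<close>, which exceeds \<open>N\<close>.\<close>
    have "(\<lambda>s. ln (y s / s) - (\<Sum>m\<le>2 * Suc N. fps_nth F m / s ^ m)) \<in> o[at_top](\<lambda>s. 1 / s ^ N)"
      unfolding F y_def
      by (rule smallo_one_over_power[OF brouncker_log_expansion[OF assms(1)]]) simp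
    moreover have "2 * Suc N \<ge> N" by simp
    ultimately show "\<exists>M\<ge>N. (\<lambda>s. ln (y s / s) - (\<Sum>m\<le>M. fps_nth F m / s ^ m)) \<in> o[at_top](\<lambda>s. 1 / s ^ N)"
      by blast
  qed
  then have expansion: "has_asymp_expansion (\<lambda>s. exp (ln (y s / s))) (fps_exp_of F)"
    by (rule has_asymp_expansion_exp) (simp add: F_def)
  \<comment> \<open>Positivity of \<open>y s\<close> lets \<open>exp\<close> undo
    \<open>ln\<close>.\<close>
  have "eventually (\<lambda>s. exp (ln (y s / s)) = y s / s) at_top"
    using eventually_gt_at_top[of 0]
  proof eventually_elim
    case (elim s)
    have "y s > 0"
      using brouncker_bounds(1)[OF assms(1) elim] elim unfolding y_def by linarith
    with elim show ?case by simp
  qed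
  then have eq: "eventually (\<lambda>s. exp (ln (y s / s)) - (\<Sum>m\<le>N. fps_nth (fps_exp_of F) m / s ^ m) =
      y s / s - (\<Sum>m\<le>N. fps_nth (fps_exp_of F) m / s ^ m)) at_top" for N
    by eventually_elim simp
  show ?thesis
    using expansion unfolding has_asymp_expansion_def landau_o.small.in_cong[OF eq] .
qed

end
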